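(* For every $k\in\mathbb{N}$ and every $n\in\mathbb{N}$ there are vectors $x_1,\dots,x_n\in c_{00}$ such that, with $x=\sum_{i=1}^n x_i$: (1) $\|x_i\|_k=\tfrac12$ for $i=1,\dots,n$; (2) $\|x\|_k\le 1$; (3) $\|x\|_{k+1}\ge \tfrac n4$.
   Context: $c_{00}$ denotes the vector space of finitely supported real sequences, with canonical basis $(t_n)_{n\ge 1}$. For finite nonempty $E,F\subset\mathbb{N}$ write $E<F$ if $\max E<\min F$, and $k\le E$ if $k\le\min E$; for $x=\sum_n a_nt_n$ put $Ex=\sum_{n\in E}a_nt_n$. The iterates of the Tsirelson (Figiel–Johnson) norm are defined by $\|x\|_0=\max_n|a_n|$ and, for $m\ge 0$, \[ \|x\|_{m+1}=\max\Big\{\|x\|_m,\ \max\Big\{\tfrac12\sum_{i=1}^{k}\|E_ix\|_m : k\in\mathbb{N},\ k\le E_1<E_2<\dots<E_k\Big\}\Big\}. \] $\|\cdot\|_m$ is called the $m$-th iterate in the construction of the Tsirelson norm. *)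

theory Defs
  imports Complex_Main "HOL-Library.Poly_Mapping"
begin

text \<open>
  Basis vectors are indexed by the positive integers, so coordinate \<open>0\<close> is required to vanish.
  The basis vector \<open>t\<^sub>n\<close> is \<^term>\<open>Poly_Mapping.single n (1::real)\<close>.
\<close>

definition c00 :: "(nat \<Rightarrow>\<^sub>0 real) set" where
  "c00 = {x. Poly_Mapping.keys x \<subseteq> {1..}}"

text \<open>The vector \<open>Ex\<close>, for finite \<open>E\<close>.\<close>

definition proj :: "nat set \<Rightarrow> (nat \<Rightarrow>\<^sub>0 real) \<Rightarrow> (nat \<Rightarrow>\<^sub>0 real)" where
  "proj E x = (\<Sum>n\<in>E. Poly_Mapping.single n (Poly_Mapping.lookup x n))"

text \<open>\<open>k \<le> E\<^sub>1 < E\<^sub>2 < \<dots> < E\<^sub>k\<close> for finite nonempty sets of positive integers.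
  Values of \<open>E\<close> outside \<open>{1..k}\<close> are irrelevant.\<close>

definition admissible :: "nat \<Rightarrow> (nat \<Rightarrow> nat set) \<Rightarrow> bool" where
  "admissible k E \<longleftrightarrow> 1 \<le> k
     \<and> (\<forall>i\<in>{1..k}. finite (E i) \<and> E i \<noteq> {} \<and> E i \<subseteq> {1..})
     \<and> k \<le> Min (E 1)
     \<and> (\<forall>i\<in>{1..<k}. Max (E i) < Min (E (Suc i)))"

text \<open>Both maxima below range over infinite families having only finitely many distinct values;
  see \<open>finite_coords\<close> and \<open>finite_admissible_sums\<close>.\<close>

primrec tsirelson_norm :: "nat \<Rightarrow> (nat \<Rightarrow>\<^sub>0 real) \<Rightarrow> real" where
  "tsirelson_norm 0 x = Max {\<bar>Poly_Mapping.lookup x n\<bar> | n. 1 \<le> n}"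
| "tsirelson_norm (Suc m) x =
     max (tsirelson_norm m x)
         (Max {1 / 2 * (\<Sum>i=1..k. tsirelson_norm m (proj (E i) x)) | k E. admissible k E})"

lemma finite_coords: "finite {\<bar>Poly_Mapping.lookup x n\<bar> | n. 1 \<le> n}"
  for x :: "nat \<Rightarrow>\<^sub>0 real"
proof (rule finite_subset)
  show "{\<bar>Poly_Mapping.lookup x n\<bar> | n. 1 \<le> n}
      \<subseteq> insert 0 ((\<lambda>n. \<bar>Poly_Mapping.lookup x n\<bar>) ` Poly_Mapping.keys x)"
    by (force simp: in_keys_iff)
qed simp

lemma admissible_singleton: "admissible 1 (\<lambda>_. {1})"
  by (simp add: admissible_def)

lemma proj_zero [simp]: "proj E 0 = 0"
  by (simp add: proj_def)

lemma tsirelson_norm_zero [simp]: "tsirelson_norm m 0 = 0"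
proof (induction m)
  case 0
  have "{\<bar>Poly_Mapping.lookup (0 :: nat \<Rightarrow>\<^sub>0 real) n\<bar> | n. 1 \<le> n} = {0}" by auto
  then show ?case by (simp del: lookup_zero)
next
  case (Suc m)
  have "{1 / 2 * (\<Sum>i=1..k. tsirelson_norm m (proj (E i) 0)) | k E. admissible k E} = {0}"
    using Suc admissible_singleton by auto
  then show ?case using Suc by simp
qed

lemma proj_Int_keys:
  assumes "finite E"
  shows "proj (E \<inter> Poly_Mapping.keys x) x = proj E x"
  unfolding proj_def using assms
  by (intro sum.mono_neutral_left) (auto simp: in_keys_iff)

lemma admissible_less:
  assumes "admissible k E" "1 \<le> i" "i < j" "j \<le> k" "a \<in> E i" "b \<in> E j"
  shows "a < b"
  using assms(3,4,6)
proof (induction j arbitrary: b)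
  case 0
  then show ?case by simp
next
  case (Suc j)
  have j: "j \<in> {1..<k}" "j \<in> {1..k}" "Suc j \<in> {1..k}" using Suc.prems assms(2) by auto
  then have fin: "finite (E j)" "E j \<noteq> {}" "finite (E (Suc j))"
    and lt: "Max (E j) < Min (E (Suc j))"
    using assms(1) unfolding admissible_def by blast+
  have step: "c < b" if "c \<in> E j" for c
    using Max_ge[OF fin(1) that] Min_le[OF fin(3) Suc.prems(3)] lt by linarith
  show ?case
  proof (cases "i = j")
    case True
    then show ?thesis using step assms(5) by blast
  next
    case False
    obtain c where c: "c \<in> E j" using fin(2) by blast
    have "a < c" using Suc.IH[OF _ _ c] False Suc.prems by auto
    then show ?thesis using step[OF c] by simp
  qed
qed

lemma finite_admissible_sums:
  "finite {1 / 2 * (\<Sum>i=1..k. tsirelson_norm m (proj (E i) x)) | k E. admissible k E}"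
proof (rule finite_subset)
  let ?S = "Poly_Mapping.keys x"
  let ?g = "\<lambda>F. 1 / 2 * (\<Sum>A\<in>F. tsirelson_norm m (proj A x))"
  show "finite (?g ` Pow (Pow ?S))" by simp
  show "{1 / 2 * (\<Sum>i=1..k. tsirelson_norm m (proj (E i) x)) | k E. admissible k E}
      \<subseteq> ?g ` Pow (Pow ?S)"
  proof clarify
    fix k E assume adm: "admissible k E"
    let ?I = "{i \<in> {1..k}. E i \<inter> ?S \<noteq> {}}"
    have fin: "finite (E i)" if "i \<in> {1..k}" for i
      using adm that unfolding admissible_def by blast
    have inj: "inj_on (\<lambda>i. E i \<inter> ?S) ?I"
    proof (rule inj_onI, rule ccontr)
      fix i j assume ij: "i \<in> ?I" "j \<in> ?I" "E i \<inter> ?S = E j \<inter> ?S" "i \<noteq> j"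
      then obtain a where "a \<in> E i" "a \<in> E j" by blast
      then show False
        using ij admissible_less[OF adm, of i j a a] admissible_less[OF adm, of j i a a]
        by (cases i j rule: linorder_cases) auto
    qed
    have "(\<Sum>i=1..k. tsirelson_norm m (proj (E i) x))
        = (\<Sum>i=1..k. tsirelson_norm m (proj (E i \<inter> ?S) x))"
      by (intro sum.cong refl) (simp add: proj_Int_keys fin)
    also have "\<dots> = (\<Sum>i\<in>?I. tsirelson_norm m (proj (E i \<inter> ?S) x))"
      by (rule sum.mono_neutral_right) (auto simp: proj_def)
    also have "\<dots> = (\<Sum>A\<in>(\<lambda>i. E i \<inter> ?S) ` ?I. tsirelson_norm m (proj A x))"
      by (subst sum.reindex[OF inj]) (simp only: o_def)
    finally show "1 / 2 * (\<Sum>i=1..k. tsirelson_norm m (proj (E i) x)) \<in> ?g ` Pow (Pow ?S)"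
      by (intro image_eqI[where x = "(\<lambda>i. E i \<inter> ?S) ` ?I"]) auto
  qed
qed

end

theory Submission imports Defs
begin

text \<open>
  Call \<open>y\<close> \<open>\<epsilon>\<close>-flat at level \<open>k + 1\<close> if \<open>\<parallel>y\<parallel>\<^sub>k\<^sub>+\<^sub>1 = 1/2\<close> and \<open>\<parallel>y\<parallel>\<^sub>k \<le> \<epsilon>\<close>.
  Let \<open>S\<close> be supported in \<open>{1..N}\<close> and let \<open>y\<close> be \<open>\<epsilon>\<close>-flat. An admissible family that meets the
  support of \<open>S\<close> has at most \<open>N\<close> members, hence collects at most \<open>N \<epsilon> / 2\<close> from \<open>y\<close>; one that
  does not meet it sees only \<open>y\<close>. So \<open>\<parallel>S + y\<parallel>\<^sub>k\<^sub>+\<^sub>1 \<le> max (1/2) (\<parallel>S\<parallel>\<^sub>k\<^sub>+\<^sub>1 + (N + 1) \<epsilon>)\<close>,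
  and flat vectors can be appended one after another, with \<open>\<epsilon>\<close> chosen small depending
  on the past, without the norm ever reaching \<open>1\<close>. Conversely, \<open>n\<close> successive vectors
  supported beyond \<open>n\<close>, each of norm \<open>1/2\<close> at level \<open>k\<close> and with sum of norm at most \<open>1\<close>, have a
  sum of norm at least \<open>n/4\<close> at level \<open>k + 1\<close>; normalising this sum gives a
  \<open>2/n\<close>-flat vector at level \<open>k + 1\<close>, so the construction climbs from level to level.
\<close>

section \<open>Coordinate projections and admissible families\<close>

lemma lookup_proj:
  "finite E \<Longrightarrow> Poly_Mapping.lookup (proj E x) n = (if n \<in> E then Poly_Mapping.lookup x n else 0)"
  by (simp add: proj_def lookup_sum lookup_single when_def)

text \<open>This default value settles the infinite case in lemmas stated for arbitrary
  \<open>E\<close>.\<close>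

lemma proj_infinite: "infinite E \<Longrightarrow> proj E x = 0"
  by (simp add: proj_def)

lemma proj_add: "proj E (x + y) = proj E x + proj E y"
  by (simp add: proj_def lookup_add single_add sum.distrib)

lemma proj_commute: "proj A (proj B x) = proj B (proj A x)"
proof (cases "finite A \<and> finite B")
  case True
  then show ?thesis by (intro poly_mapping_eqI) (simp add: lookup_proj)
qed (auto simp: proj_infinite)

lemma proj_disjoint_keys: "E \<inter> Poly_Mapping.keys x = {} \<Longrightarrow> proj E x = 0"
  unfolding proj_def by (intro sum.neutral) (metis disjoint_iff in_keys_iff single_zero)

lemma proj_superset_keys:
  "finite E \<Longrightarrow> Poly_Mapping.keys x \<subseteq> E \<Longrightarrow> proj E x = x"
  by (intro poly_mapping_eqI) (auto simp: lookup_proj in_keys_iff subset_iff)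

lemma proj_sum: "proj E (\<Sum>i\<in>I. f i) = (\<Sum>i\<in>I. proj E (f i))"
  by (induction I rule: infinite_finite_induct) (auto simp: proj_add)

text \<open>All later sets lie above \<open>Min (E 1)\<close>, which is at least \<open>k\<close>.
  Hence a family meeting \<open>{..N}\<close> has at most \<open>N\<close> members.\<close>

lemma admissible_card_le:
  assumes "admissible k E" "i \<in> {1..k}" "a \<in> E i"
  shows "k \<le> a"
proof -
  have 1: "finite (E 1)" "E 1 \<noteq> {}" "k \<le> Min (E 1)"
    using assms(1) unfolding admissible_def by auto
  show ?thesis
  proof (cases "i = 1")
    case True
    then show ?thesis using Min_le[OF 1(1)] 1(3) assms(3) by fastforce
  next
    case False
    then have "Min (E 1) < a"
      using admissible_less[OF assms(1), of 1 i "Min (E 1)" a] assms(2,3) Min_in[OF 1(1,2)] by auto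
    then show ?thesis using 1(3) by simp
  qed
qed

section \<open>Seminorm properties of the iterates\<close>

lemma tsirelson_norm_0_le_iff:
  "tsirelson_norm 0 x \<le> B \<longleftrightarrow> (\<forall>n\<ge>1. \<bar>Poly_Mapping.lookup x n\<bar> \<le> B)"
  unfolding tsirelson_norm.simps
  by (subst Max_le_iff[OF finite_coords]) auto

text \<open>\<open>Max\<close> is meaningful only on finite nonempty sets; once this is discharged
  here, later estimates bound one admissible family at a time.\<close>

lemma tsirelson_norm_Suc_le_iff:
  "tsirelson_norm (Suc m) x \<le> B \<longleftrightarrow> tsirelson_norm m x \<le> B \<and>
     (\<forall>k E. admissible k E \<longrightarrow> 1 / 2 * (\<Sum>i=1..k. tsirelson_norm m (proj (E i) x)) \<le> B)"
proof -
  have ne: "{1 / 2 * (\<Sum>i=1..k. tsirelson_norm m (proj (E i) x)) | k E. admissible k E} \<noteq> {}"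
    using admissible_singleton by blast
  show ?thesis
    unfolding tsirelson_norm.simps max.bounded_iff
    by (subst Max_le_iff[OF finite_admissible_sums ne]) blast
qed

lemma lookup_le_tsirelson_norm_0: "1 \<le> n \<Longrightarrow> \<bar>Poly_Mapping.lookup x n\<bar> \<le> tsirelson_norm 0 x"
  using tsirelson_norm_0_le_iff by blast

lemma tsirelson_norm_le_Suc: "tsirelson_norm m x \<le> tsirelson_norm (Suc m) x"
  using tsirelson_norm_Suc_le_iff by blast

lemma admissible_sum_le_tsirelson_norm:
  "admissible k E \<Longrightarrow>
    (\<Sum>i=1..k. tsirelson_norm m (proj (E i) x)) \<le> 2 * tsirelson_norm (Suc m) x"
  using tsirelson_norm_Suc_le_iff[of m x "tsirelson_norm (Suc m) x"]
  by (fastforce simp del: tsirelson_norm.simps)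

lemma tsirelson_norm_nonneg: "0 \<le> tsirelson_norm m x"
proof (induction m)
  case 0
  show ?case using lookup_le_tsirelson_norm_0[of 1 x] by simp
next
  case (Suc m)
  then show ?case using tsirelson_norm_le_Suc order_trans by blast
qed

lemma tsirelson_norm_triangle:
  "tsirelson_norm m (x + y) \<le> tsirelson_norm m x + tsirelson_norm m y"
proof (induction m arbitrary: x y)
  case 0
  show ?case
    unfolding tsirelson_norm_0_le_iff lookup_add
    by (meson abs_triangle_ineq add_mono lookup_le_tsirelson_norm_0 order_trans)
next
  case (Suc m)
  have "1 / 2 * (\<Sum>i=1..k. tsirelson_norm m (proj (E i) (x + y)))
      \<le> tsirelson_norm (Suc m) x + tsirelson_norm (Suc m) y" if "admissible k E" for k E
  proof -
    have "(\<Sum>i=1..k. tsirelson_norm m (proj (E i) (x + y)))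
        \<le> (\<Sum>i=1..k. tsirelson_norm m (proj (E i) x) + tsirelson_norm m (proj (E i) y))"
      by (intro sum_mono) (simp add: proj_add Suc)
    then show ?thesis
      using admissible_sum_le_tsirelson_norm[OF that, of m x]
        admissible_sum_le_tsirelson_norm[OF that, of m y]
      by (simp add: sum.distrib del: tsirelson_norm.simps)
  qed
  then show ?case
    unfolding tsirelson_norm_Suc_le_iff[of _ "x + y"]
    using Suc[of x y] tsirelson_norm_le_Suc[of m x] tsirelson_norm_le_Suc[of m y] by fastforce
qed

text \<open>Projections commute, so the induction hypothesis applies to each
  \<open>proj (F i) x\<close>.\<close>

lemma tsirelson_norm_proj_le: "tsirelson_norm m (proj E x) \<le> tsirelson_norm m x"
proof (induction m arbitrary: x)
  case 0
  show ?case
  proof (cases "finite E")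
    case True
    then show ?thesis
      by (auto simp: tsirelson_norm_0_le_iff lookup_proj lookup_le_tsirelson_norm_0
          tsirelson_norm_nonneg simp del: tsirelson_norm.simps)
  next
    case False
    then show ?thesis by (simp add: proj_infinite tsirelson_norm_nonneg del: tsirelson_norm.simps)
  qed
next
  case (Suc m)
  have "1 / 2 * (\<Sum>i=1..k. tsirelson_norm m (proj (F i) (proj E x))) \<le> tsirelson_norm (Suc m) x"
    if "admissible k F" for k F
  proof -
    have "(\<Sum>i=1..k. tsirelson_norm m (proj (F i) (proj E x)))
        \<le> (\<Sum>i=1..k. tsirelson_norm m (proj (F i) x))"
      by (intro sum_mono) (subst proj_commute, rule Suc)
    then show ?thesis using admissible_sum_le_tsirelson_norm[OF that, of m x] by linarith
  qed
  then show ?case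
    unfolding tsirelson_norm_Suc_le_iff[of _ "proj E x"]
    using Suc[of x] tsirelson_norm_le_Suc[of m x] by fastforce
qed

definition scale :: "real \<Rightarrow> (nat \<Rightarrow>\<^sub>0 real) \<Rightarrow> (nat \<Rightarrow>\<^sub>0 real)" where
  "scale c x = Poly_Mapping.map ((*) c) x"

lemma lookup_scale [simp]: "Poly_Mapping.lookup (scale c x) n = c * Poly_Mapping.lookup x n"
  by (simp add: scale_def Poly_Mapping.map.rep_eq when_def)

lemma keys_scale_subset: "Poly_Mapping.keys (scale c x) \<subseteq> Poly_Mapping.keys x"
  by (auto simp: in_keys_iff)

lemma proj_scale: "proj E (scale c x) = scale c (proj E x)"
proof (cases "finite E")
  case True
  then show ?thesis by (intro poly_mapping_eqI) (simp add: lookup_proj)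
next
  case False
  then show ?thesis by (intro poly_mapping_eqI) (simp add: proj_infinite)
qed

lemma tsirelson_norm_scale_le:
  assumes "0 \<le> c"
  shows "tsirelson_norm m (scale c x) \<le> c * tsirelson_norm m x"
proof (induction m arbitrary: x)
  case 0
  show ?case
    using assms
    by (auto simp: tsirelson_norm_0_le_iff abs_mult lookup_le_tsirelson_norm_0 mult_left_mono
        simp del: tsirelson_norm.simps)
next
  case (Suc m)
  have "1 / 2 * (\<Sum>i=1..k. tsirelson_norm m (proj (F i) (scale c x)))
      \<le> c * tsirelson_norm (Suc m) x" if "admissible k F" for k F
  proof -
    have "(\<Sum>i=1..k. tsirelson_norm m (proj (F i) (scale c x)))
        \<le> (\<Sum>i=1..k. c * tsirelson_norm m (proj (F i) x))"
      by (intro sum_mono) (simp add: proj_scale Suc)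
    also have "\<dots> \<le> c * (2 * tsirelson_norm (Suc m) x)"
      unfolding sum_distrib_left[symmetric]
      by (intro mult_left_mono admissible_sum_le_tsirelson_norm that assms)
    finally show ?thesis by linarith
  qed
  moreover have "c * tsirelson_norm m x \<le> c * tsirelson_norm (Suc m) x"
    by (intro mult_left_mono tsirelson_norm_le_Suc assms)
  ultimately show ?case
    unfolding tsirelson_norm_Suc_le_iff[of _ "scale c x"] using Suc[of x] by fastforce
qed

text \<open>The reverse inequality is the previous lemma for the factor \<open>1 / c\<close> and the
  vector \<open>scale c x\<close>.\<close>

lemma tsirelson_norm_scale:
  assumes "0 < c"
  shows "tsirelson_norm m (scale c x) = c * tsirelson_norm m x"
proof (rule antisym)
  have "scale (1 / c) (scale c x) = x"
    using assms by (intro poly_mapping_eqI) simp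
  then have "tsirelson_norm m x \<le> 1 / c * tsirelson_norm m (scale c x)"
    using tsirelson_norm_scale_le[of "1 / c" m "scale c x"] assms by simp
  then show "c * tsirelson_norm m x \<le> tsirelson_norm m (scale c x)"
    using assms by (simp add: field_simps)
qed (use assms tsirelson_norm_scale_le in simp)

section \<open>Appending a vector of norm one half\<close>

lemma keys_bounded:
  obtains N where "Poly_Mapping.keys (x :: nat \<Rightarrow>\<^sub>0 real) \<subseteq> {..N}"
  using finite_nat_set_iff_bounded_le[of "Poly_Mapping.keys x"] by (auto simp: subset_iff)

text \<open>The invariant of the induction on the level. The maximum, in place of the triangle bound
  \<open>tsirelson_norm k S + 1 / 2\<close>, is what permits repeated appending below norm
  1.\<close>

definition appendable :: "nat \<Rightarrow> bool" where
  "appendable k \<longleftrightarrow> (\<forall>S M \<delta>. 0 < \<delta> \<longrightarrow>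
     (\<exists>y. Poly_Mapping.keys y \<subseteq> {Suc M..} \<and> tsirelson_norm k y = 1 / 2 \<and>
          tsirelson_norm k (S + y) \<le> max (1 / 2) (tsirelson_norm k S + \<delta>)))"

text \<open>For the sup norm, half a basis vector at a coordinate outside the support of
  \<open>S\<close> suffices.\<close>

lemma appendable_0: "appendable 0"
  unfolding appendable_def
proof (intro allI impI)
  fix S :: "nat \<Rightarrow>\<^sub>0 real" and M :: nat and \<delta> :: real
  assume \<delta>: "0 < \<delta>"
  obtain N where N: "Poly_Mapping.keys S \<subseteq> {..N}" using keys_bounded .
  \<comment> \<open>Beyond both \<open>M\<close> and the support of \<open>S\<close>; also positive,
    since the norm ignores coordinate 0.\<close>
  define p where "p = Suc (max M N)"
  define y where "y = Poly_Mapping.single p (1 / 2 :: real)"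
  have Sp: "Poly_Mapping.lookup S p = 0"
    using N by (auto simp: p_def subset_iff in_keys_iff)
  have "tsirelson_norm 0 y = 1 / 2"
  proof (rule antisym)
    show "tsirelson_norm 0 y \<le> 1 / 2"
      unfolding tsirelson_norm_0_le_iff y_def by (auto simp: lookup_single when_def)
    show "1 / 2 \<le> tsirelson_norm 0 y"
      using lookup_le_tsirelson_norm_0[of p y] by (simp add: y_def p_def)
  qed
  moreover have "tsirelson_norm 0 (S + y) \<le> max (1 / 2) (tsirelson_norm 0 S + \<delta>)"
    unfolding tsirelson_norm_0_le_iff
  proof (intro allI impI)
    fix n :: nat assume "1 \<le> n"
    then have "\<bar>Poly_Mapping.lookup S n\<bar> \<le> tsirelson_norm 0 S"
      by (rule lookup_le_tsirelson_norm_0)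
    then show "\<bar>Poly_Mapping.lookup (S + y) n\<bar> \<le> max (1 / 2) (tsirelson_norm 0 S + \<delta>)"
      using \<delta> Sp by (cases "n = p") (auto simp: lookup_add y_def lookup_single when_def
          simp del: tsirelson_norm.simps)
  qed
  moreover have "Poly_Mapping.keys y \<subseteq> {Suc M..}"
    by (simp add: y_def p_def)
  ultimately show "\<exists>y. Poly_Mapping.keys y \<subseteq> {Suc M..} \<and> tsirelson_norm 0 y = 1 / 2 \<and>
          tsirelson_norm 0 (S + y) \<le> max (1 / 2) (tsirelson_norm 0 S + \<delta>)"
    by blast
qed

section \<open>Successive blocks\<close>

text \<open>Starting at \<open>Suc M\<close> excludes coordinate 0 for every \<open>M\<close>. The
  order is stated pointwise, so it needs no \<open>Max\<close> or \<open>Min\<close> of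
  supports.\<close>

definition half_blocks :: "nat \<Rightarrow> nat \<Rightarrow> nat \<Rightarrow> (nat \<Rightarrow> nat \<Rightarrow>\<^sub>0 real) \<Rightarrow> bool" where
  "half_blocks k M n x \<longleftrightarrow>
    (\<forall>i\<in>{1..n}. Poly_Mapping.keys (x i) \<subseteq> {Suc M..} \<and> tsirelson_norm k (x i) = 1 / 2) \<and>
    (\<forall>i\<in>{1..n}. \<forall>j\<in>{1..n}. i < j \<longrightarrow>
       (\<forall>a\<in>Poly_Mapping.keys (x i). \<forall>b\<in>Poly_Mapping.keys (x j). a < b))"

lemma half_blocks_keys:
  "half_blocks k M n x \<Longrightarrow> i \<in> {1..n} \<Longrightarrow> Poly_Mapping.keys (x i) \<subseteq> {Suc M..}"
  unfolding half_blocks_def by blast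

lemma half_blocks_norm:
  "half_blocks k M n x \<Longrightarrow> i \<in> {1..n} \<Longrightarrow> tsirelson_norm k (x i) = 1 / 2"
  unfolding half_blocks_def by blast

lemma half_blocks_less:
  "\<lbrakk>half_blocks k M n x; i \<in> {1..n}; j \<in> {1..n}; i < j;
    a \<in> Poly_Mapping.keys (x i); b \<in> Poly_Mapping.keys (x j)\<rbrakk> \<Longrightarrow> a < b"
  unfolding half_blocks_def by blast

text \<open>The bound is strict so that every append leaves a positive gap below 1 for the next
  one.\<close>

lemma appendable_imp_blocks:
  assumes "appendable k"
  shows "\<exists>x. half_blocks k M n x \<and> tsirelson_norm k (\<Sum>i=1..n. x i) < 1"
proof (induction n)
  case 0
  show ?case by (simp add: half_blocks_def)
next
  case (Suc n)
  then obtain x where x: "half_blocks k M n x" and sum: "tsirelson_norm k (\<Sum>i=1..n. x i) < 1"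
    by blast
  define S where "S = (\<Sum>i=1..n. x i)"
  have "finite (\<Union>i\<in>{1..n}. Poly_Mapping.keys (x i))" by simp
  then obtain N where N: "\<And>i a. i \<in> {1..n} \<Longrightarrow> a \<in> Poly_Mapping.keys (x i) \<Longrightarrow> a \<le> N"
    unfolding finite_nat_set_iff_bounded_le by blast
  \<comment> \<open>The tolerance is half the remaining gap; \<open>max M N\<close> puts
    \<open>y\<close> after all earlier blocks.\<close>
  obtain y where y: "Poly_Mapping.keys y \<subseteq> {Suc (max M N)..}" "tsirelson_norm k y = 1 / 2"
    "tsirelson_norm k (S + y) \<le> max (1 / 2) (tsirelson_norm k S + (1 - tsirelson_norm k S) / 2)"
    using assms sum unfolding appendable_def S_def by (meson diff_gt_0_iff_gt half_gt_zero)
  have lt1: "tsirelson_norm k (S + y) < 1"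
    using y(3) sum unfolding S_def[symmetric] le_max_iff_disj by argo
  have less: "a < b" if "i \<in> {1..Suc n}" "j \<in> {1..Suc n}" "i < j"
    "a \<in> Poly_Mapping.keys ((x(Suc n := y)) i)" "b \<in> Poly_Mapping.keys ((x(Suc n := y)) j)" for i j a b
  proof (cases "j = Suc n")
    case True
    then have "a \<le> N" "Suc N \<le> b" using that N[of i a] y(1) by auto
    then show ?thesis by simp
  next
    case False
    then show ?thesis using that half_blocks_less[OF x, of i j a b] by auto
  qed
  have "Poly_Mapping.keys ((x(Suc n := y)) i) \<subseteq> {Suc M..} \<and>
      tsirelson_norm k ((x(Suc n := y)) i) = 1 / 2" if "i \<in> {1..Suc n}" for i
    using half_blocks_keys[OF x, of i] half_blocks_norm[OF x, of i] y(1,2) that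
    by (auto simp: subset_iff)
  then have "half_blocks k M (Suc n) (x(Suc n := y))"
    unfolding half_blocks_def by (intro conjI ballI impI) (blast, blast, rule less)
  moreover have "(\<Sum>i=1..Suc n. (x(Suc n := y)) i) = S + y"
    by (simp add: S_def)
  ultimately show ?case using lt1 by metis
qed

text \<open>The supports themselves form an admissible family of size \<open>n\<close>, since the
  first starts at \<open>Suc M\<close> or later; each contributes 1/2, and the factor 1/2 of the
  norm gives \<open>n / 4\<close>.\<close>

lemma blocks_lower_bound:
  assumes x: "half_blocks k M n x" and "n \<le> Suc M"
  shows "real n / 4 \<le> tsirelson_norm (Suc k) (\<Sum>i=1..n. x i)"
\<comment> \<open>Admissible families have at least one member, so \<open>n = 0\<close> is
  separate.\<close>
proof (cases "n = 0")
  case True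
  then show ?thesis by (simp add: tsirelson_norm_nonneg del: tsirelson_norm.simps)
next
  case False
  define E where "E i = Poly_Mapping.keys (x i)" for i
  \<comment> \<open>An empty support would give norm 0 instead of 1/2.\<close>
  have ne: "E i \<noteq> {}" if "i \<in> {1..n}" for i
    using half_blocks_norm[OF x that] by (auto simp: E_def)
  have fin: "finite (E i)" for i by (simp add: E_def)
  have "n \<le> Min (E 1)"
    using half_blocks_keys[OF x, of 1] ne[of 1] fin[of 1] False \<open>n \<le> Suc M\<close>
    by (force simp: E_def)
  moreover have "Max (E i) < Min (E (Suc i))" if "i \<in> {1..<n}" for i
    using half_blocks_less[OF x, of i "Suc i" "Max (E i)" "Min (E (Suc i))"] ne[of i] ne[of "Suc i"] fin that
    by (metis E_def Max_in Min_in Suc_leI atLeastAtMost_iff atLeastLessThan_iff le_SucI lessI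
        less_imp_le)
  ultimately have adm: "admissible n E"
    using False half_blocks_keys[OF x] ne fin unfolding admissible_def by (fastforce simp: E_def)
  have "proj (E i) (\<Sum>j=1..n. x j) = x i" if i: "i \<in> {1..n}" for i
  proof -
    have "proj (E i) (x j) = (if j = i then x i else 0)" if "j \<in> {1..n}" for j
    proof (cases "j = i")
      case True
      then show ?thesis by (simp add: E_def proj_superset_keys)
    next
      case False
      then have "E i \<inter> Poly_Mapping.keys (x j) = {}"
        using half_blocks_less[OF x, of i j] half_blocks_less[OF x, of j i] i that unfolding E_def
        by (metis disjoint_iff less_irrefl linorder_neqE_nat)
      then show ?thesis using False by (simp add: proj_disjoint_keys)
    qed
    then show ?thesis using i by (simp add: proj_sum)
  qed
  then have "(\<Sum>i=1..n. tsirelson_norm k (proj (E i) (\<Sum>j=1..n. x j))) = (\<Sum>i=1..n. 1 / 2)"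
    by (intro sum.cong) (simp_all add: half_blocks_norm[OF x])
  then show ?thesis using admissible_sum_le_tsirelson_norm[OF adm, of k "\<Sum>j=1..n. x j"]
    by (simp del: tsirelson_norm.simps)
qed

section \<open>Flat vectors and the induction on the level\<close>

lemma appendable_imp_flat:
  assumes "appendable k" "0 < \<epsilon>"
  shows "\<exists>y. Poly_Mapping.keys y \<subseteq> {Suc M..} \<and> tsirelson_norm (Suc k) y = 1 / 2 \<and>
    tsirelson_norm k y \<le> \<epsilon>"
proof -
  \<comment> \<open>The normalising factor \<open>c\<close> below is at most \<open>2 / n\<close>,
    and the sum has level-\<open>k\<close> norm below 1.\<close>
  obtain n :: nat where n: "2 / \<epsilon> < real n" using reals_Archimedean2 by blast
  then have n0: "0 < real n" using assms(2) by (smt (verit) divide_pos_pos)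
  \<comment> \<open>\<open>M\<close> serves the support condition, \<open>n\<close> the size
    condition of \<open>blocks_lower_bound\<close>.\<close>
  obtain x where x: "half_blocks k (max M n) n x" and sum: "tsirelson_norm k (\<Sum>i=1..n. x i) < 1"
    using appendable_imp_blocks[OF assms(1)] by blast
  define z where "z = (\<Sum>i=1..n. x i)"
  define c where "c = 1 / (2 * tsirelson_norm (Suc k) z)"
  have lower: "real n / 4 \<le> tsirelson_norm (Suc k) z"
    unfolding z_def by (rule blocks_lower_bound[OF x]) simp
  then have pos: "0 < tsirelson_norm (Suc k) z" using n0 by linarith
  then have c: "0 < c" by (simp add: c_def del: tsirelson_norm.simps)
  have "c \<le> 1 / (2 * (real n / 4))"
    unfolding c_def using lower n0 by (intro divide_left_mono) auto
  also have "\<dots> \<le> \<epsilon>" using n n0 assms(2) by (simp add: field_simps)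
  finally have c_le: "c \<le> \<epsilon>" .
  have "tsirelson_norm k (scale c z) \<le> c * 1"
    using c sum unfolding tsirelson_norm_scale[OF c] z_def by (intro mult_left_mono) auto
  moreover have "tsirelson_norm (Suc k) (scale c z) = 1 / 2"
    unfolding tsirelson_norm_scale[OF c] using pos by (simp add: c_def del: tsirelson_norm.simps)
  moreover have "Poly_Mapping.keys z \<subseteq> {Suc M..}"
  proof -
    have "Poly_Mapping.keys z \<subseteq> (\<Union>i\<in>{1..n}. Poly_Mapping.keys (x i))"
      unfolding z_def by (rule keys_sum)
    also have "\<dots> \<subseteq> {Suc M..}" using half_blocks_keys[OF x] by fastforce
    finally show ?thesis .
  qed
  ultimately show ?thesis
    using c_le keys_scale_subset[of c z] by (intro exI[of _ "scale c z"]) auto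
qed

text \<open>The two entries of the maximum match families missing and meeting the support of
  \<open>S\<close>. The factor \<open>Suc N\<close> is at least 1 even for \<open>N = 0\<close>, so
  it also absorbs the error \<epsilon> in the level-\<open>k\<close> norm of
  \<open>S + y\<close>.\<close>

lemma tsirelson_norm_append_flat_le:
  assumes S: "Poly_Mapping.keys S \<subseteq> {..N}" and flat: "tsirelson_norm k y \<le> \<epsilon>"
  shows "tsirelson_norm (Suc k) (S + y)
    \<le> max (tsirelson_norm (Suc k) y) (tsirelson_norm (Suc k) S + real (Suc N) * \<epsilon>)"
  unfolding tsirelson_norm_Suc_le_iff[of _ "S + y"]
proof (intro conjI allI impI)
  have \<epsilon>: "0 \<le> \<epsilon>" using flat tsirelson_norm_nonneg order_trans by blast
  then have "\<epsilon> \<le> real (Suc N) * \<epsilon>" by (simp add: mult_le_cancel_right1)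
  then have "tsirelson_norm k (S + y) \<le> tsirelson_norm (Suc k) S + real (Suc N) * \<epsilon>"
    using tsirelson_norm_triangle[of k S y] tsirelson_norm_le_Suc[of k S] flat by linarith
  then show "tsirelson_norm k (S + y)
      \<le> max (tsirelson_norm (Suc k) y) (tsirelson_norm (Suc k) S + real (Suc N) * \<epsilon>)"
    by linarith
  fix m E assume adm: "admissible m E"
  show "1 / 2 * (\<Sum>i=1..m. tsirelson_norm k (proj (E i) (S + y)))
      \<le> max (tsirelson_norm (Suc k) y) (tsirelson_norm (Suc k) S + real (Suc N) * \<epsilon>)"
  proof (cases "\<exists>i\<in>{1..m}. E i \<inter> Poly_Mapping.keys S \<noteq> {}")
    case True
    then obtain i a where "i \<in> {1..m}" "a \<in> E i" "a \<in> Poly_Mapping.keys S" by blast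
    then have "m \<le> N" using admissible_card_le[OF adm] S by fastforce
    have "(\<Sum>i=1..m. tsirelson_norm k (proj (E i) (S + y)))
        \<le> (\<Sum>i=1..m. tsirelson_norm k (proj (E i) S) + \<epsilon>)"
    proof (rule sum_mono)
      fix i
      show "tsirelson_norm k (proj (E i) (S + y)) \<le> tsirelson_norm k (proj (E i) S) + \<epsilon>"
        using tsirelson_norm_triangle[of k "proj (E i) S" "proj (E i) y"]
          tsirelson_norm_proj_le[of k "E i" y] flat by (simp add: proj_add)
    qed
    also have "\<dots> = (\<Sum>i=1..m. tsirelson_norm k (proj (E i) S)) + real m * \<epsilon>"
      by (simp add: sum.distrib)
    also have "\<dots> \<le> 2 * tsirelson_norm (Suc k) S + real (Suc N) * \<epsilon>"
      using \<open>m \<le> N\<close> \<epsilon> by (intro add_mono admissible_sum_le_tsirelson_norm adm mult_right_mono) auto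
    finally have "1 / 2 * (\<Sum>i=1..m. tsirelson_norm k (proj (E i) (S + y)))
        \<le> tsirelson_norm (Suc k) S + real (Suc N) * \<epsilon>"
      using \<open>\<epsilon> \<le> real (Suc N) * \<epsilon>\<close> \<epsilon> by linarith
    then show ?thesis by linarith
  next
    case False
    then have "(\<Sum>i=1..m. tsirelson_norm k (proj (E i) (S + y)))
        = (\<Sum>i=1..m. tsirelson_norm k (proj (E i) y))"
      by (intro sum.cong) (simp_all add: proj_add proj_disjoint_keys)
    then show ?thesis using admissible_sum_le_tsirelson_norm[OF adm, of k y] by linarith
  qed
qed

lemma appendable_Suc:
  assumes "appendable k"
  shows "appendable (Suc k)"
  unfolding appendable_def
proof (intro allI impI)
  fix S :: "nat \<Rightarrow>\<^sub>0 real" and M :: nat and \<delta> :: real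
  assume \<delta>: "0 < \<delta>"
  obtain N where N: "Poly_Mapping.keys S \<subseteq> {..N}" using keys_bounded .
  \<comment> \<open>The flatness is chosen after \<open>N\<close>, so that the total error
    \<open>Suc N\<close> times it is exactly \<delta>.\<close>
  obtain y where y: "Poly_Mapping.keys y \<subseteq> {Suc M..}" "tsirelson_norm (Suc k) y = 1 / 2"
    "tsirelson_norm k y \<le> \<delta> / real (Suc N)"
    using appendable_imp_flat[OF assms, of "\<delta> / real (Suc N)" M] \<delta> by auto
  have "real (Suc N) * (\<delta> / real (Suc N)) = \<delta>" by simp
  then show "\<exists>y. Poly_Mapping.keys y \<subseteq> {Suc M..} \<and> tsirelson_norm (Suc k) y = 1 / 2 \<and>
          tsirelson_norm (Suc k) (S + y) \<le> max (1 / 2) (tsirelson_norm (Suc k) S + \<delta>)"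
    using tsirelson_norm_append_flat_le[OF N y(3)] y(1,2) by metis
qed

lemma appendable: "appendable k"
  by (induction k) (simp_all add: appendable_0 appendable_Suc)

theorem theorem7p3:
  fixes k n :: nat
  shows "\<exists>x :: nat \<Rightarrow> (nat \<Rightarrow>\<^sub>0 real).
           (\<forall>i\<in>{1..n}. x i \<in> c00)
         \<and> (\<forall>i\<in>{1..n}. tsirelson_norm k (x i) = 1 / 2)
         \<and> tsirelson_norm k (\<Sum>i=1..n. x i) \<le> 1
         \<and> tsirelson_norm (k + 1) (\<Sum>i=1..n. x i) \<ge> real n / 4"
proof -
  \<comment> \<open>Starting the blocks beyond \<open>n\<close> makes the family of \<open>n\<close>
    supports admissible.\<close>
  obtain x where x: "half_blocks k n n x" and sum: "tsirelson_norm k (\<Sum>i=1..n. x i) < 1"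
    using appendable_imp_blocks[OF appendable] by blast
  have "real n / 4 \<le> tsirelson_norm (Suc k) (\<Sum>i=1..n. x i)"
    by (rule blocks_lower_bound[OF x]) simp
  moreover have "x i \<in> c00" if "i \<in> {1..n}" for i
    using half_blocks_keys[OF x that] by (auto simp: c00_def)
  ultimately show ?thesis
    using half_blocks_norm[OF x] sum by (intro exI[of _ x]) (simp del: tsirelson_norm.simps)
qed

end
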